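(* If $f(z)=z+a_2z^2+\cdots\in\mathcal{C}$, then $$\operatorname{Re}\sqrt{f'(z)}>\alpha\qquad\text{for all }z\in\mathbb{D},$$ where $$\alpha=\frac{10+|a_2|-\sqrt{|a_2|^2+20|a_2|+4}}{12}.$$
   Context: $\mathbb{D}=\{z\in\mathbb{C}:|z|<1\}$. $\mathcal{A}$ is the class of analytic functions $f$ in $\mathbb{D}$ of the form $f(z)=z+a_2z^2+a_3z^3+\cdots$. $\mathcal{C}$ (convex functions) is the class of $f\in\mathcal{A}$ with $\operatorname{Re}\left(1+\frac{zf''(z)}{f'(z)}\right)>0$ for all $z\in\mathbb{D}$. For such $f$ the derivative $f'$ has no zeros in $\mathbb{D}$, and $\sqrt{f'(z)}$ denotes the analytic branch in $\mathbb{D}$ taking the value $1$ at $z=0$. *)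

theory Defs
  imports "HOL-Complex_Analysis.Complex_Analysis"
begin

(* The coefficient of z^n in the Maclaurin expansion of f. *)
definition taylor_coeff :: "(complex \<Rightarrow> complex) \<Rightarrow> nat \<Rightarrow> complex"
  where "taylor_coeff f n = fps_nth (fps_expansion f 0) n"

definition class_A :: "(complex \<Rightarrow> complex) set"
  where "class_A = {f. f analytic_on ball 0 1 \<and> taylor_coeff f 0 = 0 \<and> taylor_coeff f 1 = 1}"

(* Pitfall: with x / 0 = 0 the inequality alone does not visibly exclude zeros of f'.
   It does exclude them: see convex_deriv_nonzero. *)
definition class_C :: "(complex \<Rightarrow> complex) set"
  where "class_C = {f \<in> class_A.
    \<forall>z\<in>ball 0 1. Re (1 + z * deriv (deriv f) z / deriv f z) > 0}"

definition sqrt_branch :: "(complex \<Rightarrow> complex) \<Rightarrow> (complex \<Rightarrow> complex) \<Rightarrow> bool"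
  where "sqrt_branch h g \<longleftrightarrow>
    g analytic_on ball 0 1 \<and> (\<forall>z\<in>ball 0 1. (g z)\<^sup>2 = h z) \<and> g 0 = 1"

lemma convex_deriv_nonzero:
  assumes f: "f \<in> class_C" and z: "z \<in> ball 0 1"
  shows "deriv f z \<noteq> 0"
proof
  assume zero: "deriv f z = 0"
  have holf: "f holomorphic_on ball 0 1" and d0: "deriv f 0 = 1"
    and ineq: "\<And>w. w \<in> ball 0 1 \<Longrightarrow> Re (1 + w * deriv (deriv f) w / deriv f w) > 0"
    using f by (auto simp: class_C_def class_A_def taylor_coeff_def fps_expansion_def
        analytic_on_open)
  have hol': "deriv f holomorphic_on ball 0 1"
    by (intro holomorphic_deriv holf open_ball)
  define F where "F = (\<lambda>w. w * deriv f w)"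
  define \<phi> where "\<phi> = (\<lambda>r::real. (norm (F (of_real r * z)))\<^sup>2)"
  have inball: "of_real r * z \<in> ball 0 1" if "0 \<le> r" "r \<le> 1" for r :: real
    using that z by (auto simp: norm_mult intro: le_less_trans[OF mult_left_le_one_le])
  have nondecr: "\<exists>y. DERIV \<phi> r :> y \<and> y \<ge> 0" if r: "0 < r" "r \<le> 1" for r
  proof -
    define w where "w = of_real r * z"
    have w: "w \<in> ball 0 1" using inball[of r] r by (simp add: w_def)
    define D where "D = deriv f w + w * deriv (deriv f) w"
    have "(deriv f has_field_derivative deriv (deriv f) w) (at w)"
      by (rule holomorphic_derivI[OF hol' open_ball w])
    then have "(F has_field_derivative D) (at w)"
      unfolding F_def D_def by (auto intro!: derivative_eq_intros)
    moreover have lin: "((\<lambda>r. of_real r * z) has_vector_derivative z) (at r)"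
      unfolding has_vector_derivative_def by (auto intro!: derivative_eq_intros simp: scaleR_conv_of_real)
    ultimately have "((\<lambda>r. F (of_real r * z)) has_vector_derivative (z * D)) (at r)"
      using field_vector_diff_chain_at[of "\<lambda>r. of_real r * z" z r F D] lin
      by (simp add: w_def o_def)
    then have vd: "((\<lambda>r. F (of_real r * z)) has_derivative (\<lambda>x. x *\<^sub>R (z * D))) (at r)"
      by (simp add: has_vector_derivative_def)
    have der: "(\<phi> has_real_derivative 2 * (F w \<bullet> (z * D))) (at r)"
      unfolding \<phi>_def power2_norm_eq_inner has_field_derivative_def
      by (rule has_derivative_eq_rhs[OF has_derivative_inner[OF vd vd]])
         (simp add: w_def inner_commute fun_eq_iff)
    have "F w \<bullet> (z * D) \<ge> 0"
    proof (cases "deriv f w = 0")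
      case True
      then show ?thesis by (simp add: F_def)
    next
      case False
      define q where "q = 1 + w * deriv (deriv f) w / deriv f w"
      have D: "D = deriv f w * q" using False by (simp add: D_def q_def field_simps)
      have "F w = of_real r * (z * deriv f w)" by (simp add: F_def w_def)
      then have "F w \<bullet> (z * D) = r * ((z * deriv f w) \<bullet> ((z * deriv f w) * q))"
        by (simp add: D inner_complex_def algebra_simps)
      also have "\<dots> = r * ((norm (z * deriv f w))\<^sup>2 * Re q)"
        unfolding cmod_power2 inner_complex_def by (simp add: algebra_simps power2_eq_square)
      finally show ?thesis using ineq[OF w] r by (simp add: q_def)
    qed
    with der show ?thesis by (intro exI[of _ "2 * (F w \<bullet> (z * D))"]) auto
  qed
  have znz: "z \<noteq> 0" using zero d0 by auto
  have van: "deriv f (of_real r * z) = 0" if "0 < r" "r \<le> 1" for r :: real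
  proof -
    have "\<phi> r \<le> \<phi> 1"
    proof (rule DERIV_nonneg_imp_nondecreasing[OF that(2)])
      fix x :: real
      assume "r \<le> x" "x \<le> 1"
      then show "\<exists>y. DERIV \<phi> x :> y \<and> y \<ge> 0"
        using that(1) by (intro nondecr) linarith+
    qed
    also have "\<phi> 1 = 0" using zero by (simp add: \<phi>_def F_def)
    finally have "F (of_real r * z) = 0" by (simp add: \<phi>_def)
    then show ?thesis using that znz by (simp add: F_def)
  qed
  have "continuous_on (ball 0 1) (deriv f)"
    by (rule holomorphic_on_imp_continuous_on[OF hol'])
  then have "isCont (deriv f) 0"
    by (simp add: continuous_on_eq_continuous_at)
  moreover have "(\<lambda>n. of_real (inverse (real (Suc n))) * z) \<longlonglongrightarrow> 0"
    using tendsto_mult_right[OF tendsto_of_real[OF LIMSEQ_inverse_real_of_nat], of z] by simp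
  ultimately have "(\<lambda>n. deriv f (of_real (inverse (real (Suc n))) * z)) \<longlonglongrightarrow> deriv f 0"
    by (rule isCont_tendsto_compose)
  moreover have "deriv f (of_real (inverse (real (Suc n))) * z) = 0" for n
    by (rule van) (simp_all add: inverse_le_1_iff)
  ultimately have "deriv f 0 = 0" by (simp only: LIMSEQ_const_iff)
  with d0 show False by simp
qed

lemma sqrt_branch_exists:
  assumes f: "f \<in> class_C"
  shows "\<exists>g. sqrt_branch (deriv f) g"
proof -
  have holf: "f holomorphic_on ball 0 1" and d0: "deriv f 0 = 1"
    using f by (auto simp: class_C_def class_A_def taylor_coeff_def fps_expansion_def
        analytic_on_open)
  have hol': "deriv f holomorphic_on ball 0 1"
    by (intro holomorphic_deriv holf open_ball)
  obtain g where g: "g holomorphic_on ball 0 1" "\<And>z. z \<in> ball 0 1 \<Longrightarrow> deriv f z = (g z)\<^sup>2"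
    using contractible_imp_holomorphic_sqrt[OF hol' convex_imp_contractible[OF convex_ball]]
      convex_deriv_nonzero[OF f] by blast
  have "(g 0)\<^sup>2 = 1" using g(2)[of 0] d0 by simp
  then have "g 0 = 1 \<or> g 0 = -1" by (simp add: power2_eq_1_iff)
  then show ?thesis
  proof
    assume "g 0 = 1"
    then show ?thesis using g by (auto simp: sqrt_branch_def analytic_on_open)
  next
    assume "g 0 = -1"
    then have "sqrt_branch (deriv f) (\<lambda>z. - g z)"
      using g by (auto simp: sqrt_branch_def analytic_on_open intro: holomorphic_on_minus)
    then show ?thesis by blast
  qed
qed

end

theory Submission
  imports Defs
begin

text \<open>
  If \<open>Re g > \<alpha>\<close> fails, let \<open>y\<close> be a point of least modulus with \<open>Re (g y) = \<alpha>\<close> and put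
  \<open>p x = (g (y x) - \<alpha>) / (1 - \<alpha>)\<close>. This \<open>p\<close> has positive real part on the disc, \<open>p 0 = 1\<close>, and
  \<open>Re (p 1) = 0\<close>. The Schwarz lemma with fixed second coefficient gives a lower bound for \<open>Re p\<close>
  along the radius to \<open>1\<close>, hence an upper bound for \<open>Re (p' 1)\<close>; minimality of \<open>Re p\<close> on the
  circle makes \<open>p' 1\<close> real. Since \<open>1 + y f''(y) / f'(y) = 1 + 2 y g'(y) / g(y)\<close>, this bound makes
  the real part nonpositive as soon as \<open>4 (1 - \<alpha>)\<^sup>2 \<ge> (2 (1 - \<alpha>) + |a\<^sub>2|) \<alpha>\<close> and \<open>\<alpha> \<ge> 1/2\<close>.
  The given \<open>\<alpha>\<close> is the smaller root of this quadratic, and it is at least \<open>1/2\<close> because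
  \<open>|a\<^sub>2| \<le> 1\<close> for convex functions.
\<close>

section \<open>The Schwarz lemma with prescribed derivative at the origin\<close>

text \<open>A pseudo-hyperbolic disc of radius \<open>r\<close> about \<open>a\<close> is farthest
  from the origin on the ray through \<open>a\<close>, so the bound is the one for real
  \<open>a\<close> and \<open>u\<close>.\<close>

lemma norm_le_of_Moebius_norm_le:
  fixes a u :: complex
  assumes a: "norm a < 1" and u: "norm u < 1" and r: "0 \<le> r" "r < 1"
    and le: "norm (Moebius_function 0 a u) \<le> r"
  shows "norm u \<le> (r + norm a) / (1 + norm a * r)"
proof -
  define A where "A = norm a"
  define x where "x = norm u"
  have A: "0 \<le> A" "A < 1" and x: "0 \<le> x" "x < 1" using a u by (auto simp: A_def x_def)
  have Ax: "A * x < 1" using A x mult_strict_mono'[of A 1 x 1] by simp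
  have tri: "1 - A * x \<le> norm (1 - cnj a * u)"
    using norm_triangle_ineq2[of 1 "cnj a * u"] by (simp add: norm_mult A_def x_def)
  have pos: "norm (1 - cnj a * u) > 0" using tri Ax by linarith
  have ident: "(norm (1 - cnj a * u))\<^sup>2 - (norm (u - a))\<^sup>2 = (1 - A\<^sup>2) * (1 - x\<^sup>2)"
    unfolding A_def x_def cmod_power2 by (simp add: power2_eq_square algebra_simps)
  have "norm (u - a) \<le> r * norm (1 - cnj a * u)"
    using le pos by (simp add: Moebius_function_simple norm_divide divide_le_eq)
  then have "(norm (u - a))\<^sup>2 \<le> r\<^sup>2 * (norm (1 - cnj a * u))\<^sup>2"
    by (metis norm_ge_zero power_mono power_mult_distrib)
  then have 1: "(1 - r\<^sup>2) * (norm (1 - cnj a * u))\<^sup>2 \<le> (1 - A\<^sup>2) * (1 - x\<^sup>2)"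
    using ident by (simp add: algebra_simps)
  have "(1 - A * x)\<^sup>2 \<le> (norm (1 - cnj a * u))\<^sup>2"
    using tri Ax by (intro power_mono) auto
  moreover have "0 \<le> 1 - r\<^sup>2" using r by (simp add: power_le_one)
  ultimately have "(1 - r\<^sup>2) * (1 - A * x)\<^sup>2 \<le> (1 - A\<^sup>2) * (1 - x\<^sup>2)"
    using 1 by (meson mult_left_mono order_trans)
  \<comment> \<open>The identity \<open>ident\<close> for the real points \<open>A\<close> and
    \<open>x\<close>, namely \<open>(1 - A * x)^2 - (x - A)^2 = (1 - A^2) * (1 - x^2)\<close>, is
    used backwards.\<close>
  then have "(x - A)\<^sup>2 \<le> (r * (1 - A * x))\<^sup>2"
    by (simp add: power2_eq_square algebra_simps)
  moreover have "0 \<le> r * (1 - A * x)" using r Ax by simp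
  ultimately have "x - A \<le> r * (1 - A * x)" by (rule power2_le_imp_le)
  moreover have "0 < 1 + A * r" using A r by (simp add: add_pos_nonneg)
  ultimately show ?thesis
    by (simp add: pos_le_divide_eq algebra_simps flip: A_def x_def)
qed

text \<open>The quotient \<open>h z = w z / z\<close> maps into the closed disc with
  \<open>h 0 = deriv w 0\<close>. By Schwarz-Pick, \<open>h z\<close> has pseudo-hyperbolic distance
  at most \<open>norm z\<close> from \<open>h 0\<close>.\<close>

lemma Schwarz_Lemma_fixed_coeff:
  assumes hol: "w holomorphic_on ball 0 1" and w0: "w 0 = 0"
    and lt: "\<And>z. norm z < 1 \<Longrightarrow> norm (w z) < 1" and z: "norm z < 1"
  defines "c \<equiv> norm (deriv w 0)"
  shows "norm (w z) \<le> norm z * ((norm z + c) / (1 + c * norm z))"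
proof -
  obtain h where hol_h: "h holomorphic_on ball 0 1"
    and wh: "\<And>z. norm z < 1 \<Longrightarrow> w z = z * h z" and h0: "deriv w 0 = h 0"
    using Schwarz3[OF hol w0] by blast
  have c: "c = norm (h 0)" by (simp add: c_def h0)
  have h_le: "norm (h z) \<le> 1" if "norm z < 1" for z
  proof (cases "z = 0")
    case True
    then show ?thesis using Schwarz_Lemma(2)[OF hol w0 lt, of 0] by (simp add: h0)
  next
    case False
    then show ?thesis using Schwarz_Lemma(1)[OF hol w0 lt that] wh[OF that]
      by (simp add: norm_mult)
  qed
  have "norm (h z) \<le> (norm z + c) / (1 + c * norm z)"
  \<comment> \<open>The Moebius map centred at \<open>h 0\<close> needs
    \<open>norm (h 0) < 1\<close>. If \<open>h\<close> attains modulus 1, it is constant, and the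
    bound reads 1 because \<open>c = 1\<close>.\<close>
  proof (cases "\<exists>y. norm y < 1 \<and> norm (h y) = 1")
    case True
    then obtain y where y: "norm y < 1" "norm (h y) = 1" by blast
    have "h constant_on ball 0 1"
      using maximum_modulus_principle[OF hol_h _ _ _ order_refl, of y] y h_le by auto
    then have "h 0 = h y" using y by (auto simp: constant_on_def)
    then have "c = 1" using y by (simp add: c)
    moreover have "0 < 1 + norm z" by (simp add: add_pos_nonneg)
    ultimately show ?thesis using h_le[OF z] by (simp add: add.commute)
  next
    case False
    then have h_lt: "norm (h z) < 1" if "norm z < 1" for z
      using h_le[OF that] that by force
    define u where "u = Moebius_function 0 (h 0) \<circ> h"
    have "u holomorphic_on ball 0 1"
      unfolding u_def using h_lt
      by (intro holomorphic_on_compose_gen[OF hol_h Moebius_function_holomorphic]) auto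
    moreover have "norm (u y) < 1" if "norm y < 1" for y
      unfolding u_def o_def using h_lt that by (intro Moebius_function_norm_lt_1) auto
    moreover have "u 0 = 0" by (simp add: u_def Moebius_function_eq_zero)
    ultimately have "norm (u z) \<le> norm z" using Schwarz_Lemma(1) z by blast
    then show ?thesis
      unfolding c using h_lt z by (intro norm_le_of_Moebius_norm_le) (auto simp: u_def)
  qed
  then show ?thesis
    unfolding wh[OF z] norm_mult by (intro mult_left_mono) auto
qed

section \<open>Functions with positive real part\<close>

text \<open>The Cayley transform carries the right half-plane to the disc and 1 to 0, with
  derivative -1/2 at 1, so Schwarz estimates become available for \<open>p\<close>.\<close>

lemma Re_pos_imp_Cayley:
  fixes p :: "complex \<Rightarrow> complex"
  assumes hol: "p holomorphic_on ball 0 1" and p0: "p 0 = 1"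
    and pos: "\<And>z. norm z < 1 \<Longrightarrow> Re (p z) > 0"
  defines "w \<equiv> \<lambda>z. (1 - p z) / (1 + p z)"
  shows "w holomorphic_on ball 0 1" "w 0 = 0" "\<And>z. norm z < 1 \<Longrightarrow> norm (w z) < 1"
    "deriv w 0 = - deriv p 0 / 2"
proof -
  have nz: "1 + p z \<noteq> 0" if "norm z < 1" for z
  proof
    assume "1 + p z = 0"
    then have "Re (1 + p z) = 0" by simp
    then show False using pos[OF that] by simp
  qed
  show "w holomorphic_on ball 0 1"
    unfolding w_def using nz by (intro holomorphic_intros hol) auto
  show "w 0 = 0" by (simp add: w_def p0)
  show "norm (w z) < 1" if "norm z < 1" for z
  proof -
    have "(norm (1 - p z))\<^sup>2 < (norm (1 + p z))\<^sup>2"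
      using pos[OF that] unfolding cmod_power2 by (simp add: power2_eq_square algebra_simps)
    then have "norm (1 - p z) < norm (1 + p z)" by (rule power2_less_imp_less) simp
    then show ?thesis using nz[OF that] by (simp add: w_def norm_divide)
  qed
  have "(p has_field_derivative deriv p 0) (at 0)"
    by (rule holomorphic_derivI[OF hol]) auto
  then have "(w has_field_derivative - deriv p 0 / 2) (at 0)"
    unfolding w_def using nz[of 0] by (auto intro!: derivative_eq_intros simp: p0)
  then show "deriv w 0 = - deriv p 0 / 2" by (rule DERIV_imp_deriv)
qed

text \<open>Caratheodory's bound for the first coefficient; it later yields \<open>a \<le> 1\<close>
  for convex functions.\<close>

lemma Re_pos_imp_norm_deriv_le_2:
  assumes "p holomorphic_on ball 0 1" "p 0 = 1" "\<And>z. norm z < 1 \<Longrightarrow> Re (p z) > 0"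
  shows "norm (deriv p 0) \<le> 2"
  using Schwarz_Lemma(2)[OF Re_pos_imp_Cayley(1-3)[OF assms], of 0]
    Re_pos_imp_Cayley(4)[OF assms] by (simp add: norm_divide)

text \<open>Follows from \<open>4 * Re p = |1 + p|^2 - |1 - p|^2\<close> and the Schwarz bound for
  the Cayley transform. The factor \<open>|1 + p|^2\<close> is kept because it has a limit at a
  boundary point, while \<open>1 - B^2\<close> carries the linear decay.\<close>

lemma Re_lower_bound_fixed_coeff:
  assumes p: "p holomorphic_on ball 0 1" "p 0 = 1" "\<And>z. norm z < 1 \<Longrightarrow> Re (p z) > 0"
    and z: "norm z < 1"
  defines "c \<equiv> norm (deriv p 0) / 2"
  defines "B \<equiv> norm z * ((norm z + c) / (1 + c * norm z))"
  shows "Re (p z) \<ge> (1 - B\<^sup>2) * (norm (1 + p z))\<^sup>2 / 4"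
proof -
  have "norm ((1 - p z) / (1 + p z)) \<le> B"
    using Schwarz_Lemma_fixed_coeff[OF Re_pos_imp_Cayley(1-3)[OF p] z]
    by (simp add: Re_pos_imp_Cayley(4)[OF p] B_def c_def norm_divide)
  moreover have "norm (1 + p z) > 0"
    using p(3)[OF z] complex_Re_le_cmod[of "1 + p z"] by (simp only: plus_complex.sel one_complex.sel)
  ultimately have "norm (1 - p z) \<le> B * norm (1 + p z)"
    by (simp add: norm_divide divide_le_eq)
  then have "(norm (1 - p z))\<^sup>2 \<le> B\<^sup>2 * (norm (1 + p z))\<^sup>2"
    by (metis norm_ge_zero power_mono power_mult_distrib)
  moreover have "(norm (1 + p z))\<^sup>2 - (norm (1 - p z))\<^sup>2 = 4 * Re (p z)"
    unfolding cmod_power2 by (simp add: power2_eq_square algebra_simps)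
  ultimately show ?thesis by (simp add: algebra_simps)
qed

text \<open>A Hopf-type estimate at a boundary zero of \<open>Re p\<close>: the tangential
  derivative vanishes at the minimum, and the radial one is the limit of difference quotients
  controlled by the interior lower bound.\<close>

lemma boundary_deriv_fixed_coeff:
  assumes hol: "p holomorphic_on S" and S: "open S" "cball 0 1 \<subseteq> S" and p0: "p 0 = 1"
    and pos: "\<And>z. norm z < 1 \<Longrightarrow> Re (p z) > 0" and p1: "Re (p 1) = 0"
  shows "Im (deriv p 1) = 0"
    and "Re (deriv p 1) \<le> - (2 * (1 + (Im (p 1))\<^sup>2) / (2 + norm (deriv p 0)))"
proof -
  define c where "c = norm (deriv p 0) / 2"
  have c: "c \<ge> 0" by (simp add: c_def)
  have hol1: "p holomorphic_on ball 0 1"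
    using hol S(2) by (meson ball_subset_cball holomorphic_on_subset order_trans)
  have inS: "z \<in> S" if "norm z \<le> 1" for z using that S(2) by auto
  have d1: "(p has_field_derivative deriv p 1) (at 1)"
    by (rule holomorphic_derivI[OF hol S(1) inS]) simp
  have cont: "continuous_on S p" by (rule holomorphic_on_imp_continuous_on[OF hol])
  have nonneg: "Re (p z) \<ge> 0" if "norm z \<le> 1" for z
  proof -
    have "continuous_on (closure (ball 0 1)) (\<lambda>z. Re (p z))"
      using S(2) by (intro continuous_on_Re continuous_on_subset[OF cont]) auto
    then show ?thesis
      by (rule continuous_ge_on_closure) (use that pos in \<open>auto intro: less_imp_le\<close>)
  qed
  show "Im (deriv p 1) = 0"
  proof -
    have vd: "((\<lambda>t. cis t) has_vector_derivative \<i>) (at 0)"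
      unfolding has_vector_derivative_def
      by (auto intro!: derivative_eq_intros simp: scaleR_conv_of_real)
    \<comment> \<open>On the unit circle \<open>Re p\<close> is minimal at \<open>t = 0\<close>, and
      its derivative there is \<open>- Im (deriv p 1)\<close>.\<close>
    have "((\<lambda>t. p (cis t)) has_vector_derivative \<i> * deriv p 1) (at 0)"
      using field_vector_diff_chain_at[OF vd, of p "deriv p 1"] d1 by (simp add: o_def)
    then have "DERIV (\<lambda>t. Re (p (cis t))) 0 :> Re (\<i> * deriv p 1)"
      by (rule has_field_derivative_Re)
    then have "Re (\<i> * deriv p 1) = 0"
      by (rule DERIV_local_min[where d = 1]) (use nonneg p1 in auto)
    then show ?thesis by simp
  qed
  have "(of_real has_vector_derivative (1::complex)) (at 1)"
    by (auto intro!: derivative_eq_intros simp: has_vector_derivative_def scaleR_conv_of_real)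
  then have "((\<lambda>t. p (of_real t)) has_vector_derivative deriv p 1) (at 1)"
    using field_vector_diff_chain_at[of of_real 1 1 p "deriv p 1"] d1 by (simp add: o_def)
  then have "((\<lambda>t. Re (p (of_real t))) has_real_derivative Re (deriv p 1)) (at 1 within {..<1})"
    by (rule has_field_derivative_at_within[OF has_field_derivative_Re])
  then have lim1: "((\<lambda>t. Re (p (of_real t)) / (t - 1)) \<longlongrightarrow> Re (deriv p 1)) (at_left 1)"
    by (simp add: has_field_derivative_iff p1)
  \<comment> \<open>Since \<open>1 - B t = (1 - t) * (1 + t) / (1 + c * t)\<close>, the factor
    \<open>t - 1\<close> cancels from the bound on the difference quotient. What remains is
    \<open>R\<close>, which has a limit at 1.\<close>
  define B where "B = (\<lambda>t. t * ((t + c) / (1 + c * t)))"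
  define R where "R = (\<lambda>t. - ((1 + t) * (1 + B t) / (1 + c * t)) * (norm (1 + p (of_real t)))\<^sup>2 / 4)"
  have "isCont p 1" using d1 by (rule DERIV_isCont)
  then have contp: "((\<lambda>t. p (of_real t)) \<longlongrightarrow> p 1) (at_left 1)"
    by (intro isCont_tendsto_compose[of _ p] tendsto_eq_intros) auto
  have lim2: "(R \<longlongrightarrow> - ((1 + 1) * (1 + B 1) / (1 + c * 1)) * (norm (1 + p 1))\<^sup>2 / 4) (at_left 1)"
    unfolding R_def B_def using c by (intro tendsto_intros contp) auto
  have ev: "\<forall>\<^sub>F t in at_left 1. Re (p (of_real t)) / (t - 1) \<le> R t"
  proof -
    have "Re (p (of_real t)) / (t - 1) \<le> R t" if t: "0 < t" "t < 1" for t
    proof -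
      have ct: "1 + c * t > 0" using c t by (simp add: add_pos_nonneg)
      have "Re (p (of_real t)) \<ge> (1 - (B t)\<^sup>2) * (norm (1 + p (of_real t)))\<^sup>2 / 4"
        using Re_lower_bound_fixed_coeff[OF hol1 p0 pos, of "of_real t"] t
        by (simp add: B_def c_def)
      then have "Re (p (of_real t)) / (t - 1)
          \<le> ((1 - (B t)\<^sup>2) * (norm (1 + p (of_real t)))\<^sup>2 / 4) / (t - 1)"
        using t by (intro divide_right_mono_neg) auto
      also have "\<dots> = (1 - B t) / (t - 1) * (1 + B t) * (norm (1 + p (of_real t)))\<^sup>2 / 4"
        by (simp add: power2_eq_square algebra_simps)
      also have "1 - B t = (t - 1) * - ((1 + t) / (1 + c * t))"
        using ct by (simp add: B_def field_simps)
      also have "\<dots> / (t - 1) = - ((1 + t) / (1 + c * t))"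
        using t by simp
      finally show ?thesis by (simp add: R_def)
    qed
    then show ?thesis
      by (intro eventually_at_leftI[of 0]) auto
  qed
  have "Re (deriv p 1) \<le> - ((1 + 1) * (1 + B 1) / (1 + c * 1)) * (norm (1 + p 1))\<^sup>2 / 4"
    by (rule tendsto_le[OF _ lim2 lim1 ev]) simp
  also have "B 1 = 1" using c by (simp add: B_def)
  also have "(norm (1 + p 1))\<^sup>2 = 1 + (Im (p 1))\<^sup>2"
    unfolding cmod_power2 by (simp add: p1)
  also have "- ((1 + 1) * (1 + 1) / (1 + c * 1)) * (1 + (Im (p 1))\<^sup>2) / 4
      = - (2 * (1 + (Im (p 1))\<^sup>2) / (2 * (1 + c)))"
    using c by (simp add: field_simps)
  also have "2 * (1 + c) = 2 + norm (deriv p 0)" by (simp add: c_def)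
  finally show "Re (deriv p 1) \<le> - (2 * (1 + (Im (p 1))\<^sup>2) / (2 + norm (deriv p 0)))" .
qed

section \<open>The constant and the first critical point\<close>

text \<open>The equation expands to \<open>6 * \<alpha>^2 - (10 + a) * \<alpha> + 4 = 0\<close>,
  with discriminant \<open>a^2 + 20 * a + 4\<close>.\<close>

lemma quadratic_root_bounds:
  fixes a :: real
  assumes a: "0 \<le> a" "a \<le> 1"
  defines "\<alpha> \<equiv> (10 + a - sqrt (a\<^sup>2 + 20 * a + 4)) / 12"
  shows "4 * (1 - \<alpha>)\<^sup>2 = (2 * (1 - \<alpha>) + a) * \<alpha>" "1 / 2 \<le> \<alpha>" "\<alpha> < 1"
proof -
  define s where "s = sqrt (a\<^sup>2 + 20 * a + 4)"
  have s: "s\<^sup>2 = a\<^sup>2 + 20 * a + 4" "s \<ge> 0" using a by (simp_all add: s_def)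
  have al: "\<alpha> = (10 + a - s) / 12" by (simp add: \<alpha>_def s_def)
  show "4 * (1 - \<alpha>)\<^sup>2 = (2 * (1 - \<alpha>) + a) * \<alpha>"
    using s(1) unfolding al by (simp add: power2_eq_square field_simps)
  \<comment> \<open>The difference of the two sides is \<open>12 * (1 - a)\<close>; this is where
    \<open>a \<le> 1\<close> enters.\<close>
  have "s\<^sup>2 \<le> (4 + a)\<^sup>2" using a unfolding s(1) by (simp add: power2_eq_square algebra_simps)
  then have "s \<le> 4 + a" by (rule power2_le_imp_le) (use a in simp)
  then show "1 / 2 \<le> \<alpha>" by (simp add: al)
  have "(2::real)\<^sup>2 \<le> s\<^sup>2" using a unfolding s(1) by simp
  then have "2 \<le> s" by (rule power2_le_imp_le) (use s in simp)
  then show "\<alpha> < 1" using a by (simp add: al)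
qed

text \<open>The set where \<open>Re g \<le> \<alpha>\<close> inside a closed disc is compact, so it
  has a point nearest the origin; continuity from the smaller disc forces equality there.\<close>

lemma first_point_Re_le:
  fixes g :: "complex \<Rightarrow> complex"
  assumes cont: "continuous_on (ball 0 1) g" and g0: "Re (g 0) > \<alpha>"
    and z: "norm z < 1" "Re (g z) \<le> \<alpha>"
  obtains y where "norm y < 1" "y \<noteq> 0" "Re (g y) = \<alpha>"
    "\<And>x. norm x < norm y \<Longrightarrow> Re (g x) > \<alpha>"
proof -
  define K where "K = {x \<in> cball 0 (norm z). Re (g x) \<le> \<alpha>}"
  have sub: "cball 0 (norm z) \<subseteq> ball 0 1" using z by auto
  have cont_z: "continuous_on (cball 0 (norm z)) (\<lambda>x. Re (g x))"
    by (intro continuous_intros continuous_on_subset[OF cont sub])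
  have "closed K" unfolding K_def
    by (intro continuous_on_closed_Collect_le cont_z continuous_intros closed_cball)
  moreover have zK: "z \<in> K" using z by (simp add: K_def)
  ultimately obtain y where y: "y \<in> K" and min: "\<And>x. x \<in> K \<Longrightarrow> dist 0 y \<le> dist 0 x"
    using distance_attains_inf[of K 0] by blast
  have y': "norm y < 1" "Re (g y) \<le> \<alpha>" "norm y \<le> norm z" using y z by (auto simp: K_def)
  have y0: "y \<noteq> 0" using y' g0 by auto
  have gt: "Re (g x) > \<alpha>" if "norm x < norm y" for x
    using min[of x] that y' by (force simp: K_def)
  have "Re (g y) \<ge> \<alpha>"
  proof (rule continuous_ge_on_closure[where f = "\<lambda>x. Re (g x)"])
    show "continuous_on (closure (ball 0 (norm y))) (\<lambda>x. Re (g x))"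
      using y0 y' by (intro continuous_on_subset[OF cont_z]) auto
    show "y \<in> closure (ball 0 (norm y))" using y0 by simp
    show "\<And>x. x \<in> ball 0 (norm y) \<Longrightarrow> \<alpha> \<le> Re (g x)" using gt by (simp add: less_imp_le)
  qed
  then show ?thesis using that y' y0 gt by force
qed

theorem theorem5p2:
  fixes f g :: "complex \<Rightarrow> complex" and \<alpha> :: real
  assumes "f \<in> class_C"
    and "sqrt_branch (deriv f) g"
    and "\<alpha> = (10 + norm (taylor_coeff f 2)
               - sqrt ((norm (taylor_coeff f 2))\<^sup>2 + 20 * norm (taylor_coeff f 2) + 4)) / 12"
  shows "\<forall>z \<in> ball 0 1. Re (g z) > \<alpha>"
proof (intro ballI, rule ccontr)
  fix z :: complex
  assume z: "z \<in> ball 0 1" and "\<not> \<alpha> < Re (g z)"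
  define a where "a = norm (taylor_coeff f 2)"
  have holf: "f holomorphic_on ball 0 1" and d0: "deriv f 0 = 1"
    and conv: "\<And>z. norm z < 1 \<Longrightarrow> Re (1 + z * deriv (deriv f) z / deriv f z) > 0"
    using assms(1) by (auto simp: class_C_def class_A_def taylor_coeff_def fps_expansion_def
        analytic_on_open)
  have a_eq: "norm (deriv (deriv f) 0) = 2 * a"
    by (simp add: a_def taylor_coeff_def fps_expansion_def norm_divide numeral_2_eq_2)
  have hol1: "deriv f holomorphic_on ball 0 1" and hol2: "deriv (deriv f) holomorphic_on ball 0 1"
    by (intro holomorphic_deriv holf open_ball)+
  have nz: "deriv f z \<noteq> 0" if "norm z < 1" for z
    using convex_deriv_nonzero[OF assms(1)] that by simp
  have holg: "g holomorphic_on ball 0 1" and sq: "\<And>z. norm z < 1 \<Longrightarrow> (g z)\<^sup>2 = deriv f z"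
    and g0: "g 0 = 1"
    using assms(2) by (auto simp: sqrt_branch_def analytic_on_open)
  have dg: "(g has_field_derivative deriv g z) (at z)" if "norm z < 1" for z
    using that by (intro holomorphic_derivI[OF holg]) auto
  have ff: "deriv (deriv f) z = 2 * g z * deriv g z" if "norm z < 1" for z
  proof -
    have "((\<lambda>z. (g z)\<^sup>2) has_field_derivative 2 * g z * deriv g z) (at z)"
      using dg[OF that] by (auto intro!: derivative_eq_intros)
    then have "(deriv f has_field_derivative 2 * g z * deriv g z) (at z)"
      by (rule has_field_derivative_transform_within_open[where S = "ball 0 1"])
         (use that sq in auto)
    then show ?thesis by (rule DERIV_imp_deriv)
  qed
  have dg0: "norm (deriv g 0) = a" using ff[of 0] a_eq g0 by (simp add: norm_mult)
  have "a \<le> 1"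
  proof -
    \<comment> \<open>\<open>P 0 = 1\<close> and \<open>deriv P 0 = deriv (deriv f) 0\<close>, of
      modulus \<open>2 * a\<close>, so Caratheodory's bound gives \<open>a \<le> 1\<close>.\<close>
    define P where "P = (\<lambda>z. 1 + z * deriv (deriv f) z / deriv f z)"
    have "P holomorphic_on ball 0 1"
      unfolding P_def using nz by (intro holomorphic_intros hol1 hol2) auto
    moreover have "Re (P z) > 0" if "norm z < 1" for z using conv[OF that] by (simp add: P_def)
    ultimately have "norm (deriv P 0) \<le> 2"
      by (intro Re_pos_imp_norm_deriv_le_2) (auto simp: P_def)
    moreover have "(P has_field_derivative deriv (deriv f) 0) (at 0)"
      unfolding P_def using d0
      by (auto intro!: derivative_eq_intros holomorphic_derivI[OF hol1 open_ball]
            holomorphic_derivI[OF hol2 open_ball])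
    then have "deriv P 0 = deriv (deriv f) 0" by (rule DERIV_imp_deriv)
    ultimately show ?thesis using a_eq by simp
  qed
  then have \<alpha>: "4 * (1 - \<alpha>)\<^sup>2 = (2 * (1 - \<alpha>) + a) * \<alpha>" "1 / 2 \<le> \<alpha>" "\<alpha> < 1"
    using quadratic_root_bounds[of a] by (simp_all add: assms(3) a_def)
  have "continuous_on (ball 0 1) g" by (rule holomorphic_on_imp_continuous_on[OF holg])
  moreover have "Re (g 0) > \<alpha>" using \<alpha> g0 by simp
  ultimately obtain y where y: "norm y < 1" "y \<noteq> 0" "Re (g y) = \<alpha>"
    and gt: "\<And>x. norm x < norm y \<Longrightarrow> Re (g x) > \<alpha>"
    using first_point_Re_le[of g \<alpha> z] z \<open>\<not> \<alpha> < Re (g z)\<close> by (auto simp: not_less)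
  define p where "p = (\<lambda>x. (g (y * x) - \<alpha>) / (1 - \<alpha>))"
  \<comment> \<open>As \<open>norm y < 1\<close>, this open set contains the closed unit disc, so
    \<open>p\<close> is holomorphic across the boundary point 1.\<close>
  define S where "S = (\<lambda>x. y * x) -` ball 0 1"
  have S: "open S" "cball 0 1 \<subseteq> S"
  proof -
    show "open S" unfolding S_def by (intro open_vimage continuous_intros open_ball)
    have "norm (y * x) < 1" if "norm x \<le> 1" for x
      using that y(1) mult_left_le[of "norm x" "norm y"] by (simp add: norm_mult)
    then show "cball 0 1 \<subseteq> S" by (auto simp: S_def)
  qed
  have dp: "(p has_field_derivative y * deriv g (y * x) / (1 - \<alpha>)) (at x)" if "norm (y * x) < 1" for x
    unfolding p_def using \<alpha>(3)
    by (auto intro!: derivative_eq_intros DERIV_chain2[where f = g and g = "\<lambda>x. y * x", OF dg[OF that]])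
  have holp: "p holomorphic_on S"
  proof -
    have "norm (y * x) < 1" if "x \<in> S" for x using that by (simp add: S_def)
    then show ?thesis unfolding holomorphic_on_open[OF S(1)] using dp by blast
  qed
  have p_lin: "g (y * x) = \<alpha> + (1 - \<alpha>) * p x" for x
    using \<alpha>(3) by (simp add: p_def)
  have Re_p: "Re (g (y * x)) = \<alpha> + (1 - \<alpha>) * Re (p x)" for x
    using p_lin[of x] by simp
  have p0: "p 0 = 1" using \<alpha>(3) by (simp add: p_def g0)
  have pos: "Re (p x) > 0" if "norm x < 1" for x
  proof -
    have "norm (y * x) < norm y" using that y(2) by (simp add: norm_mult)
    then show ?thesis using gt[of "y * x"] \<alpha>(3) by (simp add: Re_p zero_less_mult_iff)
  qed
  have p1: "Re (p 1) = 0" using Re_p[of 1] y(3) \<alpha>(3) by simp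
  define \<rho> where "\<rho> = Im (p 1)"
  define q where "q = - Re (deriv p 1)"
  have dp1: "deriv p 1 = y * deriv g y / (1 - \<alpha>)" using dp[of 1] y by (simp add: DERIV_imp_deriv)
  have dp0: "deriv p 0 = y * deriv g 0 / (1 - \<alpha>)" using dp[of 0] by (simp add: DERIV_imp_deriv)
  note bd = boundary_deriv_fixed_coeff[OF holp S p0 pos p1]
  have "deriv p 1 = - of_real q" using bd(1) by (simp add: q_def complex_eq_iff)
  then have ydg: "y * deriv g y = - of_real ((1 - \<alpha>) * q)"
    using dp1 \<alpha>(3) by (simp add: field_simps)
  have gy: "g y = Complex \<alpha> ((1 - \<alpha>) * \<rho>)"
    using p_lin[of 1] p1 by (simp add: complex_eq_iff \<rho>_def)
  \<comment> \<open>\<open>N\<close> is the squared modulus of \<open>g y\<close>, the denominator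
    of the real part below.\<close>
  define N where "N = \<alpha>\<^sup>2 + ((1 - \<alpha>) * \<rho>)\<^sup>2"
  have N: "N > 0" using \<alpha>(2) by (simp add: N_def add_pos_nonneg)
  have "1 + y * deriv (deriv f) y / deriv f y = 1 + 2 * (y * deriv g y) / g y"
  proof -
    have "g y \<noteq> 0" using sq[OF y(1)] nz[OF y(1)] by auto
    then show ?thesis unfolding ff[OF y(1)] sq[OF y(1), symmetric]
      by (simp add: power2_eq_square)
  qed
  then have "Re (1 + y * deriv (deriv f) y / deriv f y) = 1 - 2 * (1 - \<alpha>) * q * \<alpha> / N"
    unfolding ydg gy by (simp add: Re_divide N_def)
  then have "2 * (1 - \<alpha>) * q * \<alpha> / N < 1"
    using conv[OF y(1)] by linarith
  then have less: "2 * (1 - \<alpha>) * q * \<alpha> < N"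
    using N by (simp only: divide_less_eq_1_pos)
  have a0: "0 \<le> a" by (simp add: a_def)
  have "norm (deriv p 0) = norm y * a / (1 - \<alpha>)"
    unfolding dp0 norm_mult norm_divide norm_of_real dg0 using \<alpha>(3) by simp
  also have "\<dots> \<le> 1 * a / (1 - \<alpha>)"
    using y(1) a0 \<alpha>(3) by (intro divide_right_mono mult_right_mono) auto
  finally have "norm (deriv p 0) \<le> a / (1 - \<alpha>)" by simp
  then have "2 * (1 + \<rho>\<^sup>2) / (2 + a / (1 - \<alpha>)) \<le> 2 * (1 + \<rho>\<^sup>2) / (2 + norm (deriv p 0))"
    using a0 \<alpha>(3) by (intro divide_left_mono mult_pos_pos add_pos_nonneg) auto
  also have "\<dots> \<le> q" using bd(2) unfolding q_def \<rho>_def by linarith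
  finally have q: "2 * (1 + \<rho>\<^sup>2) / (2 + a / (1 - \<alpha>)) \<le> q" .
  \<comment> \<open>With this \<open>M\<close> the quadratic equation says
    \<open>4 * (1 - \<alpha>)^2 / M = \<alpha>\<close>, which turns the lower bound for
    \<open>q\<close> into \<open>\<alpha>^2 * (1 + \<rho>^2)\<close>.\<close>
  define M where "M = 2 * (1 - \<alpha>) + a"
  have M: "M > 0" using \<alpha>(3) a0 by (simp add: M_def)
  have "2 * (1 + \<rho>\<^sup>2) / (2 + a / (1 - \<alpha>)) = 2 * (1 - \<alpha>) * (1 + \<rho>\<^sup>2) / M"
    using \<alpha>(3) M by (simp add: M_def field_simps)
  then have "2 * (1 - \<alpha>) * \<alpha> * (2 * (1 - \<alpha>) * (1 + \<rho>\<^sup>2) / M) \<le> 2 * (1 - \<alpha>) * \<alpha> * q"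
    using q \<alpha> by (intro mult_left_mono) auto
  also have "2 * (1 - \<alpha>) * \<alpha> * (2 * (1 - \<alpha>) * (1 + \<rho>\<^sup>2) / M) = 4 * (1 - \<alpha>)\<^sup>2 * \<alpha> * (1 + \<rho>\<^sup>2) / M"
    by (simp add: power2_eq_square algebra_simps)
  also have "\<dots> = \<alpha>\<^sup>2 * (1 + \<rho>\<^sup>2)"
    unfolding \<alpha>(1) M_def[symmetric] using M by (simp add: power2_eq_square)
  finally have "\<alpha>\<^sup>2 * (1 + \<rho>\<^sup>2) < N" using less by (simp add: mult_ac)
  \<comment> \<open>From \<open>\<alpha> \<ge> 1/2\<close> comes
    \<open>1 - \<alpha> \<le> \<alpha>\<close>, hence
    \<open>N \<le> \<alpha>^2 * (1 + \<rho>^2)\<close>, contradicting the strict inequality just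
    obtained.\<close>
  moreover have "(1 - \<alpha>)\<^sup>2 * \<rho>\<^sup>2 \<le> \<alpha>\<^sup>2 * \<rho>\<^sup>2"
    using \<alpha> by (intro mult_right_mono power_mono) auto
  ultimately show False unfolding N_def power_mult_distrib distrib_left by simp
qed

end
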